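(* Let $r\ge 3$, let $H$ be a connected $r$-uniform hypergraph, and let $e$ be an edge of $H$ containing two distinct vertices $u,v$ of degree one and a vertex $w$ that is not of degree one. For integers $k,l\ge 0$ let $\widetilde{H}^{(r)}_{k,l}$ be the $r$-uniform hypergraph obtained from $H$ by attaching a path $A_k^{(r)}$ at $v$ and a path $A_l^{(r)}$ at $u$. Suppose $l\ge k\ge 1$ and let $x$ be the Perron-Frobenius vector of $\widetilde{H}^{(r)}_{k,l}$. Then $x(u)\ge x(v)$ and $\rho(\widetilde{H}^{(r)}_{k,l})>\rho(\widetilde{H}^{(r)}_{k-1,l+1})$.
   Context: An $r$-uniform hypergraph ($r$-graph) $H=(V,E)$ has a finite vertex set $V$ and a set $E$ of $r$-element subsets of $V$ (edges). The degree of a vertex is the number of edges containing it. The spectral radius $\rho(H)$ of an $r$-graph $H$ on vertices $v_1,\dots,v_\nu$ is the maximum of $P_H(x)=r!\sum_{\{v_{i_1},\dots,v_{i_r}\}\in E(H)}x_{i_1}\cdots x_{i_r}$ over all $x\in\mathbb{R}^\nu$ with $\sum_i|x_i|^r=1$. For connected $H$ there is a unique nonnegative vector $x$ with $\sum_i x_i^r=1$ attaining this maximum; it is called the Perron-Frobenius vector of $H$, and $x(v_i)$ denotes its coordinate at the vertex $v_i$. $A_k^{(r)}$ (path of length $k$) is the $r$-graph obtained from the ordinary path graph with edges $v_0v_1,\dots,v_{k-1}v_k$ by adding $r-2$ new vertices to each edge (all new vertices distinct, each belonging only to that edge); $A_0^{(r)}$ is the single vertex $v_0$. Attaching $A_k^{(r)}$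 at a vertex $z$ means adding a copy of the path, otherwise disjoint from everything else, with its end vertex $v_0$ identified with $z$; attaching $A_0^{(r)}$ changes nothing. *)

theory Defs
  imports "HOL-Analysis.Analysis"
begin

record 'a hypergraph =
  verts :: "'a set"
  edges :: "'a set set"

definition uniform_hypergraph :: "nat \<Rightarrow> 'a hypergraph \<Rightarrow> bool" where
  "uniform_hypergraph r H \<longleftrightarrow>
     finite (verts H) \<and> (\<forall>e\<in>edges H. e \<subseteq> verts H \<and> card e = r)"

definition vertex_degree :: "'a hypergraph \<Rightarrow> 'a \<Rightarrow> nat" where
  "vertex_degree H v = card {e \<in> edges H. v \<in> e}"

definition adjacency :: "'a hypergraph \<Rightarrow> ('a \<times> 'a) set" where
  "adjacency H = {(a, b). \<exists>e\<in>edges H. a \<in> e \<and> b \<in> e}"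

definition connected_hypergraph :: "'a hypergraph \<Rightarrow> bool" where
  "connected_hypergraph H \<longleftrightarrow>
     verts H \<noteq> {} \<and> (\<forall>a\<in>verts H. \<forall>b\<in>verts H. (a, b) \<in> (adjacency H)\<^sup>*)"

text \<open>
  A vector indexed by the vertices of \<open>H\<close> is a function on the whole vertex type; only its
  values on \<open>verts H\<close> are ever used.
\<close>

definition edge_form :: "nat \<Rightarrow> 'a hypergraph \<Rightarrow> ('a \<Rightarrow> real) \<Rightarrow> real" where
  "edge_form r H x = fact r * (\<Sum>e\<in>edges H. \<Prod>v\<in>e. x v)"

definition unit_vectors :: "nat \<Rightarrow> 'a hypergraph \<Rightarrow> ('a \<Rightarrow> real) set" where
  "unit_vectors r H = {x. (\<Sum>v\<in>verts H. \<bar>x v\<bar> ^ r) = 1}"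

text \<open>The supremum is a maximum; see \<open>spectral_radius_attained\<close> below.\<close>

definition spectral_radius :: "nat \<Rightarrow> 'a hypergraph \<Rightarrow> real" where
  "spectral_radius r H = (SUP x\<in>unit_vectors r H. edge_form r H x)"

text \<open>
  For connected \<open>H\<close> such a vector is unique up to its irrelevant values outside \<open>verts H\<close>,
  hence a predicate rather than a function.
\<close>

definition perron_frobenius_vector :: "nat \<Rightarrow> 'a hypergraph \<Rightarrow> ('a \<Rightarrow> real) \<Rightarrow> bool" where
  "perron_frobenius_vector r H x \<longleftrightarrow>
     (\<forall>v\<in>verts H. x v \<ge> 0) \<and> (\<Sum>v\<in>verts H. x v ^ r) = 1 \<and>
     edge_form r H x = spectral_radius r H"

text \<open>
  \<open>Spine i\<close> is the vertex $v_i$ of the ordinary path; \<open>Extra i j\<close>, with \<open>j < r - 2\<close>, are the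
  vertices added to the edge $v_i v_{i+1}$.
\<close>

datatype path_vertex = Spine nat | Extra nat nat

definition path_edge :: "nat \<Rightarrow> nat \<Rightarrow> path_vertex set" where
  "path_edge r i = {Spine i, Spine (Suc i)} \<union> Extra i ` {..<r - 2}"

definition hyperpath :: "nat \<Rightarrow> nat \<Rightarrow> path_vertex hypergraph" where
  "hyperpath r k =
     \<lparr>verts = Spine ` {..k} \<union> (\<Union>i<k. Extra i ` {..<r - 2}),
      edges = path_edge r ` {..<k}\<rparr>"

text \<open>
  Disjointness of the attached copy is enforced by a sum type: old vertices are tagged \<open>Inl\<close>,
  those of the path \<open>Inr\<close>, except that \<open>Spine 0\<close> becomes \<open>Inl z\<close>.
\<close>

definition glue :: "'a \<Rightarrow> path_vertex \<Rightarrow> 'a + path_vertex" where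
  "glue z p = (if p = Spine 0 then Inl z else Inr p)"

definition attach_path ::
  "nat \<Rightarrow> nat \<Rightarrow> 'a \<Rightarrow> 'a hypergraph \<Rightarrow> ('a + path_vertex) hypergraph" where
  "attach_path r k z H =
     \<lparr>verts = Inl ` verts H \<union> glue z ` verts (hyperpath r k),
      edges = (`) Inl ` edges H \<union> (`) (glue z) ` edges (hyperpath r k)\<rparr>"

text \<open>
  A path of length \<open>k\<close> is attached at \<open>v\<close> and one of length \<open>l\<close> at \<open>u\<close>. A vertex \<open>a\<close> of \<open>H\<close>
  is \<open>Inl (Inl a)\<close> in the result.
\<close>

definition two_paths ::
  "nat \<Rightarrow> 'a hypergraph \<Rightarrow> 'a \<Rightarrow> 'a \<Rightarrow> nat \<Rightarrow> nat
     \<Rightarrow> (('a + path_vertex) + path_vertex) hypergraph" where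
  "two_paths r H v u k l = attach_path r l (Inl u) (attach_path r k v H)"

lemma spectral_radius_attained:
  assumes H: "uniform_hypergraph r H" and ne: "verts H \<noteq> {}" and r: "r > 0"
  shows "\<exists>x\<in>unit_vectors r H. edge_form r H x = spectral_radius r H \<and>
           (\<forall>y\<in>unit_vectors r H. edge_form r H y \<le> edge_form r H x)"
proof -
  let ?V = "verts H"
  have fin: "finite ?V" and sub: "\<And>e. e \<in> edges H \<Longrightarrow> e \<subseteq> ?V"
    using H by (auto simp: uniform_hypergraph_def)
  define B where "B = PiE UNIV (\<lambda>v. if v \<in> ?V then {-1..1::real} else {0})"
  define K where "K = B \<inter> unit_vectors r H"
  have "compactin (product_topology (\<lambda>_. euclidean) UNIV) B"
    unfolding B_def compactin_PiE by simp
  then have "compact B"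
    by (simp add: euclidean_product_topology)
  moreover have coord: "continuous_on S (\<lambda>x::'a \<Rightarrow> real. x v)" for S v
    by (rule continuous_on_subset[OF continuous_on_product_coordinates subset_UNIV])
  have "closed (unit_vectors r H)"
    unfolding unit_vectors_def
    by (intro closed_Collect_eq continuous_on_sum continuous_on_power
        continuous_on_rabs continuous_on_const coord)
  ultimately have K: "compact K"
    unfolding K_def by blast
  have cont: "continuous_on K (edge_form r H)"
    unfolding edge_form_def
    by (intro continuous_on_mult continuous_on_const continuous_on_sum continuous_on_prod coord)
  have norm1: "\<exists>y\<in>K. edge_form r H y = edge_form r H x" if x: "x \<in> unit_vectors r H" for x
  proof
    let ?y = "\<lambda>v. if v \<in> ?V then x v else 0"
    have "\<bar>x v\<bar> \<le> 1" if v: "v \<in> ?V" for v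
    proof -
      have "\<bar>x v\<bar> ^ r \<le> (\<Sum>v\<in>?V. \<bar>x v\<bar> ^ r)"
        by (rule member_le_sum[OF v _ fin]) auto
      then have "\<bar>x v\<bar> ^ r \<le> 1" using x by (simp add: unit_vectors_def)
      then show ?thesis using r by (simp add: power_le_one_iff)
    qed
    then show "?y \<in> K"
      using x by (auto simp: K_def B_def unit_vectors_def abs_le_iff minus_le_iff)
    show "edge_form r H ?y = edge_form r H x"
      unfolding edge_form_def
      by (intro arg_cong[where f = "(*) (fact r)"] sum.cong prod.cong refl) (use sub in auto)
  qed
  obtain a where a: "a \<in> ?V" using ne by blast
  have "(\<Sum>v\<in>?V. \<bar>if v = a then 1 else 0 :: real\<bar> ^ r) = (\<Sum>v\<in>?V. if v = a then 1 else 0)"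
    using r by (intro sum.cong) auto
  then have "(\<lambda>v. if v = a then 1 else 0) \<in> unit_vectors r H"
    using a fin by (simp add: unit_vectors_def)
  then have "K \<noteq> {}" using norm1 by blast
  then obtain x where x: "x \<in> K" and max: "\<And>y. y \<in> K \<Longrightarrow> edge_form r H y \<le> edge_form r H x"
    using continuous_attains_sup[OF K _ cont] by blast
  have xu: "x \<in> unit_vectors r H" using x by (simp add: K_def)
  have max': "edge_form r H y \<le> edge_form r H x" if "y \<in> unit_vectors r H" for y
    using norm1[OF that] max by metis
  have "spectral_radius r H = edge_form r H x"
    unfolding spectral_radius_def using xu max' by (intro cSup_eq_maximum) auto
  then show ?thesis using xu max' by auto
qed

end

theory Submission
  imports Defs
begin

text \<open>
  Let \<open>x > 0\<close> be the Perron-Frobenius vector, \<open>\<mu> = \<rho> / (r - 1)!\<close> and \<open>\<alpha> = 1 / \<mu> ^ r\<close>; then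
  $\mu x(a)^r$ is the sum over the edges \<open>f\<close> at \<open>a\<close> of the products of \<open>x\<close> over \<open>f\<close>.
  The first edge of a path of length \<open>j\<close> attached at \<open>z\<close> contributes the fraction \<open>F j\<close> of this
  sum at \<open>z\<close>, where \<open>F 0 = 0\<close> and \<open>F (j + 1) = \<alpha> / (1 - F j)\<close>. So \<open>e\<close> carries the
  fraction \<open>1 - F l\<close> at \<open>u\<close> and \<open>1 - F k\<close> at \<open>v\<close>, and since \<open>F\<close> increases, \<open>x(v) \<le> x(u)\<close>.
  A second edge at \<open>w\<close> makes \<open>\<alpha> < (1 - F k) * (1 - F l)\<close>, hence \<open>F k + F (l + 1) < 1\<close>, which
  implies \<open>(1 - F k) * (1 - F l) < (1 - F (k - 1)) * (1 - F (l + 1))\<close>. Using the latter two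
  fractions for \<open>e\<close> as weights, the weighted inequality between arithmetic and geometric mean on
  every edge shows that the form of the hypergraph with tails \<open>k - 1\<close> and \<open>l + 1\<close> is smaller
  than \<open>\<rho>\<close> on every positive unit vector.
\<close>

section \<open>Weighted inequality between arithmetic and geometric mean\<close>

text \<open>The geometric mean of the numbers \<open>c a * y a ^ r\<close> is the
  \<open>r\<close>-th root of \<open>prod c f\<close> times \<open>prod y f\<close>, so weights with
  product at least 1 only help. The strict version serves the single edge \<open>e\<close> where the
  weights have product above 1.\<close>

lemma prod_le_weighted_power_sum:
  fixes c y :: "'a \<Rightarrow> real"
  assumes r: "card f = r" "r > 0" and c: "\<And>a. a \<in> f \<Longrightarrow> c a > 0"
    and y: "\<And>a. a \<in> f \<Longrightarrow> y a \<ge> 0" and c1: "prod c f \<ge> 1"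
  shows "prod y f \<le> (\<Sum>a\<in>f. c a * y a ^ r) / r"
    and "prod c f > 1 \<Longrightarrow> (\<And>a. a \<in> f \<Longrightarrow> y a > 0) \<Longrightarrow> prod y f < (\<Sum>a\<in>f. c a * y a ^ r) / r"
proof -
  have f: "finite f" "f \<noteq> {}" using r by (auto intro: card_ge_0_finite)
  have y0: "prod y f \<ge> 0" using y by (simp add: prod_nonneg)
  have root: "(prod y f ^ r) powr (1 / r) = prod y f"
  proof (cases "prod y f = 0")
    case False
    then show ?thesis using y0 r
      by (simp add: powr_realpow[symmetric] powr_powr)
  qed (use r in auto)
  have split: "(\<Prod>a\<in>f. c a * y a ^ r) = prod c f * prod y f ^ r"
    by (simp add: prod.distrib prod_power_distrib)
  have am: "(prod c f * prod y f ^ r) powr (1 / r) \<le> (\<Sum>a\<in>f. c a * y a ^ r) / r"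
    using arith_geom_mean[of f "\<lambda>a. c a * y a ^ r"] f r c y split
    by (simp add: less_imp_le sum_divide_distrib)
  have "1 * prod y f ^ r \<le> prod c f * prod y f ^ r"
    using c1 y0 by (intro mult_right_mono) auto
  then have "(prod y f ^ r) powr (1 / r) \<le> (prod c f * prod y f ^ r) powr (1 / r)"
    using y0 by (intro powr_mono2) auto
  then show "prod y f \<le> (\<Sum>a\<in>f. c a * y a ^ r) / r"
    using am root by linarith
  show "prod y f < (\<Sum>a\<in>f. c a * y a ^ r) / r"
    if c1: "prod c f > 1" and y: "\<And>a. a \<in> f \<Longrightarrow> y a > 0"
  proof -
    have y0: "prod y f > 0" using y by (simp add: prod_pos)
    have "1 * prod y f ^ r < prod c f * prod y f ^ r"
      using c1 y0 by (intro mult_strict_right_mono) auto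
    then have "(prod y f ^ r) powr (1 / r) < (prod c f * prod y f ^ r) powr (1 / r)"
      using y0 r by (intro powr_less_mono2) auto
    then show ?thesis using am root by linarith
  qed
qed

subsection \<open>Perron-Frobenius vectors\<close>

lemma uniform_finite_edges:
  assumes "uniform_hypergraph r H"
  shows "finite (edges H)"
proof -
  have "edges H \<subseteq> Pow (verts H)" "finite (verts H)"
    using assms by (auto simp: uniform_hypergraph_def)
  then show ?thesis by (meson finite_Pow_iff finite_subset)
qed

lemma uniform_finite_edge:
  assumes "uniform_hypergraph r H" "f \<in> edges H"
  shows "finite f"
  using assms by (auto simp: uniform_hypergraph_def intro: finite_subset)

text \<open>Both sides are homogeneous of degree \<open>r\<close>, so a nonzero vector can be scaled
  to norm 1. In this form perturbed vectors can be tested without normalising them.\<close>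

lemma edge_form_le_spectral_radius:
  assumes H: "uniform_hypergraph r H" and r: "r > 0"
  shows "edge_form r H y \<le> spectral_radius r H * (\<Sum>v\<in>verts H. \<bar>y v\<bar> ^ r)"
proof -
  let ?s = "\<Sum>v\<in>verts H. \<bar>y v\<bar> ^ r"
  have fin: "finite (verts H)"
    and sub: "\<And>f. f \<in> edges H \<Longrightarrow> f \<subseteq> verts H \<and> card f = r"
    using H by (auto simp: uniform_hypergraph_def)
  have s0: "?s \<ge> 0" by (simp add: sum_nonneg)
  show ?thesis
  proof (cases "?s = 0")
    case True
    then have "\<forall>v\<in>verts H. \<bar>y v\<bar> ^ r = 0"
      using fin by (subst (asm) sum_nonneg_eq_0_iff) auto
    then have z: "\<And>v. v \<in> verts H \<Longrightarrow> y v = 0" by auto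
    have "prod y f = 0" if f: "f \<in> edges H" for f
    proof -
      have "f \<noteq> {}" using sub[OF f] r by auto
      then show ?thesis using sub[OF f] z uniform_finite_edge[OF H f]
        by (auto simp: prod_zero_iff)
    qed
    then show ?thesis using True by (simp add: edge_form_def)
  next
    case False
    define c where "c = root r ?s"
    have cr: "c ^ r = ?s" "c > 0" using False s0 r by (auto simp: c_def)
    have "(\<lambda>v. y v / c) \<in> unit_vectors r H"
      using cr False by (simp add: unit_vectors_def power_divide flip: sum_divide_distrib)
    moreover have "verts H \<noteq> {}" using False by auto
    ultimately have "edge_form r H (\<lambda>v. y v / c) \<le> spectral_radius r H"
      using spectral_radius_attained[OF H _ r] by metis
    moreover have "(\<Prod>v\<in>f. y v / c) = prod y f / ?s" if "f \<in> edges H" for f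
      using sub[OF that] cr by (simp add: prod_dividef)
    then have "edge_form r H (\<lambda>v. y v / c) = edge_form r H y / ?s"
      unfolding edge_form_def by (simp flip: sum_divide_distrib)
    ultimately show ?thesis using False s0 by (simp add: divide_le_eq)
  qed
qed

text \<open>Replacing a maximiser by its absolute values keeps the norm and decreases no edge
  product.\<close>

lemma perron_frobenius_vector_exists:
  assumes H: "uniform_hypergraph r H" and ne: "verts H \<noteq> {}" and r: "r > 0"
  shows "\<exists>x. perron_frobenius_vector r H x"
proof -
  obtain x where x: "x \<in> unit_vectors r H" "edge_form r H x = spectral_radius r H"
    and max: "\<And>y. y \<in> unit_vectors r H \<Longrightarrow> edge_form r H y \<le> edge_form r H x"
    using spectral_radius_attained[OF assms] by metis
  let ?y = "\<lambda>v. \<bar>x v\<bar>"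
  have y: "?y \<in> unit_vectors r H" using x by (simp add: unit_vectors_def)
  have "prod x f \<le> prod ?y f" for f
    by (metis abs_ge_self abs_prod)
  then have "edge_form r H x \<le> edge_form r H ?y"
    unfolding edge_form_def by (intro mult_left_mono sum_mono) auto
  then have "edge_form r H ?y = spectral_radius r H" using max[OF y] x by linarith
  then have "perron_frobenius_vector r H ?y"
    using y by (simp add: perron_frobenius_vector_def unit_vectors_def)
  then show ?thesis by blast
qed

text \<open>
  If some coordinates vanished, connectedness would give an edge with both zero and nonzero
  coordinates. Raising its \<open>s < r\<close> zero coordinates to \<open>t\<close> increases the form by order
  \<open>t ^ s\<close>, but the norm only by order \<open>t ^ r\<close>.
\<close>

lemma perron_frobenius_vector_pos:
  assumes H: "uniform_hypergraph r H" and con: "connected_hypergraph H" and r: "r > 0"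
    and x: "perron_frobenius_vector r H x" and a: "a \<in> verts H"
  shows "x a > 0"
proof (rule ccontr)
  let ?\<rho> = "spectral_radius r H"
  assume "\<not> x a > 0"
  have fin: "finite (verts H)"
    and sub: "\<And>f. f \<in> edges H \<Longrightarrow> f \<subseteq> verts H \<and> card f = r"
    using H by (auto simp: uniform_hypergraph_def)
  have x0: "\<And>v. v \<in> verts H \<Longrightarrow> x v \<ge> 0" and x1: "(\<Sum>v\<in>verts H. x v ^ r) = 1"
    and xe: "edge_form r H x = ?\<rho>"
    using x by (auto simp: perron_frobenius_vector_def)
  have xa: "x a = 0" using \<open>\<not> x a > 0\<close> x0[OF a] by simp
  obtain b where b: "b \<in> verts H" "x b \<noteq> 0"
  proof -
    have "\<exists>b\<in>verts H. x b \<noteq> 0"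
    proof (rule ccontr)
      assume "\<not> ?thesis"
      then have "(\<Sum>v\<in>verts H. x v ^ r) = 0" using r by (intro sum.neutral) auto
      then show False using x1 by simp
    qed
    then show ?thesis using that by blast
  qed
  have "(b, a) \<in> (adjacency H)\<^sup>*"
    using con a b by (auto simp: connected_hypergraph_def)
  \<comment> \<open>On the way from \<open>b\<close> to \<open>a\<close> some step must lead from a
    nonzero coordinate to a zero one.\<close>
  then have "x a = 0 \<longrightarrow> (\<exists>p q. (p, q) \<in> adjacency H \<and> x p \<noteq> 0 \<and> x q = 0)"
    by (induction rule: rtrancl_induct) (use b in auto)
  then obtain p q f where f: "f \<in> edges H" "p \<in> f" "q \<in> f" "x p \<noteq> 0" "x q = 0"
    using xa by (auto simp: adjacency_def)
  define S where "S = {v \<in> f. x v = 0}"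
  define c where "c = prod x (f - S)"
  define n where "n = card S"
  have ff: "finite f" by (rule uniform_finite_edge[OF H f(1)])
  have SV: "S \<subseteq> verts H" and Sf: "S \<subseteq> f" using sub[OF f(1)] by (auto simp: S_def)
  have "S \<subset> f" using f by (auto simp: S_def)
  then have nr: "n < r" using psubset_card_mono[OF ff] sub[OF f(1)] by (auto simp: n_def)
  have c0: "c > 0" unfolding c_def
    using sub[OF f(1)] x0 by (intro prod_pos) (force simp: S_def order.order_iff_strict)
  have bound: "fact r * (t ^ n * c) \<le> ?\<rho> * (n * t ^ r)" if t: "t > 0" for t :: real
  proof -
    define y where "y = (\<lambda>v. if v \<in> S then t else x v)"
    have "(\<Sum>v\<in>verts H. \<bar>y v\<bar> ^ r) = (\<Sum>v\<in>verts H. x v ^ r + (if v \<in> S then t ^ r else 0))"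
      using t r x0 by (intro sum.cong) (auto simp: y_def S_def)
    also have "\<dots> = 1 + n * t ^ r"
      using SV fin x1 by (simp add: sum.distrib n_def Int_absorb1 flip: sum.inter_restrict)
    finally have norm: "(\<Sum>v\<in>verts H. \<bar>y v\<bar> ^ r) = 1 + n * t ^ r" .
    have le: "prod x g \<le> prod y g" if "g \<in> edges H" for g
      using sub[OF that] x0 t by (intro prod_mono) (auto simp: y_def S_def)
    have "prod y f = prod y (f - S) * prod y S"
      by (rule prod.subset_diff[OF Sf ff])
    also have "prod y (f - S) = c" unfolding c_def by (intro prod.cong) (auto simp: y_def)
    also have "prod y S = t ^ n" by (simp add: y_def n_def)
    finally have yf: "prod y f = t ^ n * c" by simp
    have xf: "prod x f = 0" using ff f by auto
    have "(\<Sum>g\<in>edges H. prod x g) + t ^ n * c \<le> (\<Sum>g\<in>edges H. prod y g)"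
      using sum_mono[of "edges H - {f}" "prod x" "prod y"] le yf xf
      by (simp add: sum.remove[OF uniform_finite_edges[OF H] f(1)])
    then have "fact r * ((\<Sum>g\<in>edges H. prod x g) + t ^ n * c) \<le> edge_form r H y"
      unfolding edge_form_def by (intro mult_left_mono) auto
    also have "\<dots> \<le> ?\<rho> * (1 + n * t ^ r)"
      using edge_form_le_spectral_radius[OF H r, of y] norm by simp
    finally show ?thesis using xe by (simp add: edge_form_def algebra_simps)
  qed
  have small: "fact r * c \<le> ?\<rho> * n * t" if t: "t > 0" "t \<le> 1" for t :: real
  proof -
    have "t ^ r = t ^ n * t ^ (r - n)" using nr by (simp flip: power_add)
    then have "t ^ n * (fact r * c) \<le> t ^ n * (?\<rho> * n * t ^ (r - n))"
      using bound[OF t(1)] by (simp add: algebra_simps)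
    then have *: "fact r * c \<le> ?\<rho> * n * t ^ (r - n)"
      using t by (simp add: mult_le_cancel_left)
    have "0 < fact r * c" using c0 by simp
    then have "?\<rho> * n * t ^ (r - n) > 0" using * by linarith
    \<comment> \<open>The sign of \<open>?\<rho> * n\<close> is not known beforehand; it follows
      from the positive left side of \<open>*\<close>.\<close>
    then have "?\<rho> * n \<ge> 0" using t by (simp add: zero_less_mult_iff)
    moreover have "t ^ (r - n) \<le> t" using t nr power_decreasing[of 1 "r - n" t] by simp
    ultimately have "?\<rho> * n * t ^ (r - n) \<le> ?\<rho> * n * t" by (intro mult_left_mono)
    then show ?thesis using * by linarith
  qed
  have pos: "0 < fact r * c" using c0 by simp
  then have R: "0 < ?\<rho> * n" using small[of 1] by simp
  \<comment> \<open>At most half of the value at which \<open>small\<close> would be an equality, so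
    that \<open>small\<close> fails.\<close>
  define t where "t = min 1 (fact r * c / (2 * (?\<rho> * n)))"
  have "t > 0" "t \<le> 1" using R pos by (auto simp: t_def)
  then have "fact r * c \<le> ?\<rho> * n * t" by (rule small)
  also have "\<dots> \<le> ?\<rho> * n * (fact r * c / (2 * (?\<rho> * n)))"
    using R by (intro mult_left_mono) (auto simp: t_def)
  also have "\<dots> = fact r * c / 2" using R by (auto simp: field_simps)
  finally show False using pos by linarith
qed

text \<open>Only the coordinate at \<open>v\<close> is varied. The homogeneous bound by the spectral
  radius is attained at \<open>x\<close>, so the difference \<open>g\<close> of its two sides, up to
  a constant, has a local minimum at 0; positivity of \<open>x v\<close> leaves room on both sides.
  The vanishing derivative, multiplied by \<open>x v\<close>, is the eigenvector equation.\<close>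

lemma perron_frobenius_vector_eigen:
  assumes H: "uniform_hypergraph r H" and con: "connected_hypergraph H" and r: "r > 0"
    and x: "perron_frobenius_vector r H x" and v: "v \<in> verts H"
  shows "spectral_radius r H / fact (r - 1) * x v ^ r =
    (\<Sum>f\<in>edges H. if v \<in> f then prod x f else 0)"
proof -
  let ?\<rho> = "spectral_radius r H"
  define D where "D = (\<Sum>f\<in>edges H. if v \<in> f then prod x (f - {v}) else 0)"
  have fin: "finite (verts H)" using H by (auto simp: uniform_hypergraph_def)
  have pos: "\<And>a. a \<in> verts H \<Longrightarrow> x a > 0"
    using perron_frobenius_vector_pos[OF H con r x] .
  have x1: "(\<Sum>v\<in>verts H. x v ^ r) = 1" and xe: "edge_form r H x = ?\<rho>"
    using x by (auto simp: perron_frobenius_vector_def)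
  have rem: "prod y f = y v * prod y (f - {v})" if "f \<in> edges H" "v \<in> f" for f and y :: "_ \<Rightarrow> real"
    by (rule prod.remove[OF uniform_finite_edge[OF H that(1)] that(2)])
  have bound: "fact r * (t * D) \<le> ?\<rho> * ((x v + t) ^ r - x v ^ r)" if t: "\<bar>t\<bar> < x v" for t
  proof -
    define y where "y = x(v := x v + t)"
    have "(\<Sum>a\<in>verts H. \<bar>y a\<bar> ^ r) = (x v + t) ^ r + (\<Sum>a\<in>verts H - {v}. x a ^ r)"
      unfolding sum.remove[OF fin v] using t pos
      by (intro arg_cong2[where f = "(+)"] sum.cong) (auto simp: y_def abs_of_pos less_imp_le)
    also have "\<dots> = 1 + ((x v + t) ^ r - x v ^ r)"
      using x1 by (simp add: sum.remove[OF fin v])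
    finally have norm: "(\<Sum>a\<in>verts H. \<bar>y a\<bar> ^ r) = 1 + ((x v + t) ^ r - x v ^ r)" .
    have "prod y f = prod x f + t * (if v \<in> f then prod x (f - {v}) else 0)"
      if f: "f \<in> edges H" for f
    proof (cases "v \<in> f")
      case True
      have "prod y (f - {v}) = prod x (f - {v})" by (intro prod.cong) (auto simp: y_def)
      then show ?thesis
        using rem[OF f True, of x] rem[OF f True, of y] True by (simp add: y_def algebra_simps)
    next
      case False
      then show ?thesis by (auto simp: y_def intro!: prod.cong)
    qed
    then have "edge_form r H y = ?\<rho> + fact r * (t * D)"
      unfolding xe[symmetric] edge_form_def D_def
      by (simp add: sum.distrib sum_distrib_left algebra_simps)
    then show ?thesis
      using edge_form_le_spectral_radius[OF H r, of y] norm by (simp add: algebra_simps)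
  qed
  define g where "g = (\<lambda>t. ?\<rho> * (x v + t) ^ r - fact r * (t * D))"
  have "(g has_real_derivative ?\<rho> * (r * x v ^ (r - 1)) - fact r * D) (at 0)"
    unfolding g_def by (auto intro!: derivative_eq_intros)
  moreover have "\<forall>t. \<bar>0 - t\<bar> < x v \<longrightarrow> g 0 \<le> g t"
    using bound by (auto simp: g_def algebra_simps)
  ultimately have "?\<rho> * (r * x v ^ (r - 1)) - fact r * D = 0"
    using DERIV_local_min pos[OF v] by blast
  moreover have "(fact r :: real) = r * fact (r - 1)" using r by (simp add: fact_reduce)
  ultimately have "real r * (?\<rho> * x v ^ (r - 1)) = real r * (fact (r - 1) * D)"
    by (simp add: algebra_simps)
  then have *: "?\<rho> / fact (r - 1) * x v ^ (r - 1) = D" using r by (simp add: field_simps)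
  have "x v * x v ^ (r - 1) = x v ^ r" using r by (simp flip: power_Suc)
  then have "?\<rho> / fact (r - 1) * x v ^ r = x v * D"
    using * by (metis mult.left_commute)
  also have "\<dots> = (\<Sum>f\<in>edges H. if v \<in> f then prod x f else 0)"
    unfolding D_def sum_distrib_left by (intro sum.cong) (auto simp: rem)
  finally show ?thesis .
qed

subsection \<open>Attached paths\<close>

lemma inj_glue: "inj (glue z)"
  by (auto simp: inj_on_def glue_def split: if_splits)

lemma glue_simps [simp]:
  "glue z (Spine 0) = Inl z" "glue z (Spine (Suc i)) = Inr (Spine (Suc i))"
  "glue z (Extra i j) = Inr (Extra i j)"
  by (simp_all add: glue_def)

text \<open>This and the next two incidence rules collapse a sum over the path edges at a vertex to
  at most two terms.\<close>

lemma Inl_in_glue_path_edge [simp]: "Inl a \<in> glue z ` path_edge r i \<longleftrightarrow> i = 0 \<and> a = z"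
  by (force simp: path_edge_def glue_def split: if_splits)

lemma Spine_in_glue_path_edge [simp]:
  "Inr (Spine (Suc n)) \<in> glue z ` path_edge r i \<longleftrightarrow> i = n \<or> i = Suc n"
  by (auto simp: path_edge_def glue_def image_iff split: if_splits)

lemma Extra_in_glue_path_edge [simp]:
  "Inr (Extra p q) \<in> glue z ` path_edge r i \<longleftrightarrow> p = i \<and> q < r - 2"
  by (auto simp: path_edge_def glue_def image_iff split: if_splits)

lemma inj_path_edge: "inj (path_edge r)"
proof (rule injI)
  fix i j assume "path_edge r i = path_edge r j"
  then have "Spine i \<in> path_edge r j" "Spine j \<in> path_edge r i"
    by (auto simp: path_edge_def)
  then show "i = j" by (auto simp: path_edge_def)
qed

lemma Spine_in_path_edge: "Spine i \<in> path_edge r i" "Spine (Suc i) \<in> path_edge r i"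
  by (auto simp: path_edge_def)

lemma card_path_edge: "r \<ge> 2 \<Longrightarrow> card (path_edge r i) = r"
proof -
  assume "r \<ge> 2"
  have "card (path_edge r i) = card {Spine i, Spine (Suc i)} + card (Extra i ` {..<r - 2})"
    unfolding path_edge_def by (intro card_Un_disjoint) auto
  also have "card (Extra i ` {..<r - 2}) = r - 2"
    by (simp add: card_image inj_on_def)
  finally show ?thesis using \<open>r \<ge> 2\<close> by simp
qed

lemma prod_glue_path_edge:
  "prod y (glue z ` path_edge r i) =
    y (glue z (Spine i)) * y (Inr (Spine (Suc i))) * (\<Prod>j<r - 2. y (Inr (Extra i j)))"
proof -
  have "prod y (glue z ` path_edge r i) = (\<Prod>p\<in>path_edge r i. y (glue z p))"
    by (simp add: prod.reindex inj_on_subset[OF inj_glue])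
  also have "\<dots> = (\<Prod>p\<in>{Spine i, Spine (Suc i)}. y (glue z p)) *
      (\<Prod>p\<in>Extra i ` {..<r - 2}. y (glue z p))"
    unfolding path_edge_def by (intro prod.union_disjoint) auto
  also have "(\<Prod>p\<in>Extra i ` {..<r - 2}. y (glue z p)) = (\<Prod>j<r - 2. y (Inr (Extra i j)))"
    by (simp add: prod.reindex inj_on_def)
  finally show ?thesis by simp
qed

lemma sum_glue_path_edge:
  "sum y (glue z ` path_edge r i) =
    y (glue z (Spine i)) + y (Inr (Spine (Suc i))) + (\<Sum>j<r - 2. y (Inr (Extra i j)))"
proof -
  have "sum y (glue z ` path_edge r i) = (\<Sum>p\<in>path_edge r i. y (glue z p))"
    by (simp add: sum.reindex inj_on_subset[OF inj_glue])
  also have "\<dots> = (\<Sum>p\<in>{Spine i, Spine (Suc i)}. y (glue z p)) +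
      (\<Sum>p\<in>Extra i ` {..<r - 2}. y (glue z p))"
    unfolding path_edge_def by (intro sum.union_disjoint) auto
  also have "(\<Sum>p\<in>Extra i ` {..<r - 2}. y (glue z p)) = (\<Sum>j<r - 2. y (Inr (Extra i j)))"
    by (simp add: sum.reindex inj_on_def)
  finally show ?thesis by (simp add: add.assoc)
qed

text \<open>Each path edge owns its far end and its extra vertices. This grouping is disjoint, so
  sums over new vertices and over new edges run over the same index \<open>i < m\<close>.\<close>

lemma verts_attach_path:
  assumes "z \<in> verts K"
  shows "verts (attach_path r m z K) = Inl ` verts K \<union>
    (\<Union>i<m. insert (Inr (Spine (Suc i))) ((\<lambda>j. Inr (Extra i j)) ` {..<r - 2}))"
proof -
  have "{..m} = insert 0 (Suc ` {..<m})"
    by (simp add: lessThan_Suc_eq_insert_0 flip: lessThan_Suc_atMost)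
  then have "glue z ` verts (hyperpath r m) =
      insert (Inl z) ((\<lambda>i. Inr (Spine (Suc i))) ` {..<m}) \<union>
      (\<Union>i<m. (\<lambda>j. Inr (Extra i j)) ` {..<r - 2})"
    by (simp add: hyperpath_def image_Un image_UN image_image)
  then show ?thesis using assms by (auto simp: attach_path_def)
qed

lemma edges_attach_path:
  "edges (attach_path r m z K) = (`) Inl ` edges K \<union> (\<lambda>i. glue z ` path_edge r i) ` {..<m}"
  by (simp add: attach_path_def hyperpath_def image_image)

lemma sum_verts_attach_path:
  assumes fin: "finite (verts K)" and z: "z \<in> verts K"
  shows "sum y (verts (attach_path r m z K)) = (\<Sum>a\<in>verts K. y (Inl a)) +
    (\<Sum>i<m. y (Inr (Spine (Suc i))) + (\<Sum>j<r - 2. y (Inr (Extra i j))))"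
proof -
  let ?P = "\<lambda>i. insert (Inr (Spine (Suc i)) :: 'a + path_vertex) ((\<lambda>j. Inr (Extra i j)) ` {..<r - 2})"
  have "sum y (verts (attach_path r m z K)) = sum y (Inl ` verts K) + sum y (\<Union>i<m. ?P i)"
    unfolding verts_attach_path[OF z] using fin by (intro sum.union_disjoint) auto
  also have "sum y (\<Union>i<m. ?P i) = (\<Sum>i<m. sum y (?P i))"
    by (intro sum.UNION_disjoint) auto
  also have "\<dots> = (\<Sum>i<m. y (Inr (Spine (Suc i))) + (\<Sum>j<r - 2. y (Inr (Extra i j))))"
    by (intro sum.cong refl, subst sum.insert) (auto simp: sum.reindex inj_on_def)
  finally show ?thesis by (simp add: sum.reindex)
qed

lemma sum_edges_attach_path:
  assumes fin: "finite (edges K)"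
  shows "sum \<phi> (edges (attach_path r m z K)) =
    (\<Sum>f\<in>edges K. \<phi> (Inl ` f)) + (\<Sum>i<m. \<phi> (glue z ` path_edge r i))"
proof -
  \<comment> \<open>A path edge contains the new vertex \<open>Inr (Spine (Suc i))\<close>, an old
    edge does not.\<close>
  have "Inl ` f \<noteq> glue z ` path_edge r i" for f i
    using Spine_in_glue_path_edge[of i z r i] by blast
  then have "sum \<phi> (edges (attach_path r m z K)) = sum \<phi> ((`) Inl ` edges K) +
      sum \<phi> ((\<lambda>i. glue z ` path_edge r i) ` {..<m})"
    unfolding edges_attach_path using fin by (intro sum.union_disjoint) auto
  moreover have "inj_on (\<lambda>i. glue z ` path_edge r i) {..<m}"
    by (auto simp: inj_on_def inj_image_eq_iff[OF inj_glue] dest: injD[OF inj_path_edge])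
  ultimately show ?thesis
    by (simp add: sum.reindex inj_on_def inj_image_eq_iff)
qed

lemma uniform_attach_path:
  assumes K: "uniform_hypergraph r K" and r: "r \<ge> 2" and z: "z \<in> verts K"
  shows "uniform_hypergraph r (attach_path r m z K)"
  unfolding uniform_hypergraph_def
proof (intro conjI ballI)
  show "finite (verts (attach_path r m z K))"
    using K unfolding verts_attach_path[OF z] by (auto simp: uniform_hypergraph_def)
  fix f assume f: "f \<in> edges (attach_path r m z K)"
  have "card (glue z ` path_edge r i) = r" for i
    using card_path_edge[OF r] card_image inj_glue inj_on_subset by (metis subset_UNIV)
  then show "card f = r"
    using f K by (auto simp: edges_attach_path uniform_hypergraph_def card_image)
  have "path_edge r i \<subseteq> verts (hyperpath r m)" if "i < m" for i
    using that by (auto simp: path_edge_def hyperpath_def)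
  then show "f \<subseteq> verts (attach_path r m z K)"
    using f K unfolding edges_attach_path
    by (fastforce simp: attach_path_def uniform_hypergraph_def)
qed

lemma sym_adjacency: "sym (adjacency H)"
  by (auto simp: adjacency_def sym_def)

lemma connected_attach_path:
  assumes K: "connected_hypergraph K" and z: "z \<in> verts K"
  shows "connected_hypergraph (attach_path r m z K)"
proof -
  let ?G = "attach_path r m z K"
  let ?R = "(adjacency ?G)\<^sup>*"
  have sym: "sym ?R" by (intro sym_rtrancl sym_adjacency)
  have edge: "(a, b) \<in> ?R" if "a \<in> f" "b \<in> f" "f \<in> edges ?G" for a b f
    using that by (auto simp: adjacency_def)
  have lift: "(Inl a, Inl b) \<in> ?R" if "(a, b) \<in> (adjacency K)\<^sup>*" for a b
    using that
  proof (induction rule: rtrancl_induct)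
    case (step b c)
    then have "(Inl b, Inl c) \<in> adjacency ?G"
      by (auto simp: adjacency_def edges_attach_path)
    then show ?case using step.IH by (rule rtrancl_into_rtrancl[rotated])
  qed simp
  have spine: "(Inl z, glue z (Spine i)) \<in> ?R" if "i \<le> m" for i
    using that
  proof (induction i)
    case (Suc i)
    have "(glue z (Spine i), glue z (Spine (Suc i))) \<in> ?R"
      using Suc.prems by (intro edge[of _ "glue z ` path_edge r i"])
        (auto simp: edges_attach_path simp del: glue_simps intro: Spine_in_path_edge)
    then show ?case using Suc by simp
  qed simp
  have extra: "(Inl z, Inr (Extra i j)) \<in> ?R" if "i < m" "j < r - 2" for i j
  proof -
    have "(glue z (Spine i), Inr (Extra i j)) \<in> ?R"
      using that by (intro edge[of _ "glue z ` path_edge r i"])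
        (auto simp: edges_attach_path intro: Spine_in_path_edge)
    then show ?thesis using spine[of i] that by simp
  qed
  have all: "(Inl z, a) \<in> ?R" if "a \<in> verts ?G" for a
    using that K z lift spine[of "Suc _"] extra
    unfolding verts_attach_path[OF z] by (auto simp: connected_hypergraph_def)
  show ?thesis
    unfolding connected_hypergraph_def
  proof (intro conjI ballI)
    show "verts ?G \<noteq> {}" using z by (auto simp: attach_path_def)
    fix a b assume "a \<in> verts ?G" "b \<in> verts ?G"
    then have "(Inl z, a) \<in> ?R" "(Inl z, b) \<in> ?R" using all by auto
    then show "(a, b) \<in> ?R" using sym by (meson rtrancl_trans symD)
  qed
qed

subsection \<open>Eigenvectors along a path\<close>

text \<open>The index counts edges from the free end of the path. The quotient is meaningful while
  the earlier values are below 1, which the lemmas below assume or prove.\<close>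

fun path_ratio :: "real \<Rightarrow> nat \<Rightarrow> real" where
  "path_ratio \<alpha> 0 = 0"
| "path_ratio \<alpha> (Suc j) = \<alpha> / (1 - path_ratio \<alpha> j)"

lemma path_ratio_pos:
  assumes "\<alpha> > 0" "j > 0" "path_ratio \<alpha> (j - 1) < 1"
  shows "path_ratio \<alpha> j > 0"
  using assms by (cases j) auto

text \<open>The map taking \<open>t\<close> to \<open>\<alpha> / (1 - t)\<close> increases for
  \<open>t < 1\<close>, so the first inequality \<open>0 < \<alpha>\<close> propagates.\<close>

lemma path_ratio_less_Suc:
  assumes "\<alpha> > 0" "\<And>i. i \<le> j \<Longrightarrow> path_ratio \<alpha> i < 1"
  shows "path_ratio \<alpha> j < path_ratio \<alpha> (Suc j)"
  using assms(2)
proof (induction j)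
  case 0
  then show ?case using assms(1) by simp
next
  case (Suc j)
  have "path_ratio \<alpha> j < path_ratio \<alpha> (Suc j)" "path_ratio \<alpha> (Suc j) < 1"
    using Suc.IH Suc.prems by (auto simp del: path_ratio.simps)
  then have "\<alpha> / (1 - path_ratio \<alpha> j) < \<alpha> / (1 - path_ratio \<alpha> (Suc j))"
    using assms(1) by (intro divide_strict_left_mono) (auto simp del: path_ratio.simps)
  then show ?case by (simp only: path_ratio.simps)
qed

lemma path_ratio_strict_mono:
  assumes \<alpha>: "\<alpha> > 0" and lt: "\<And>i. i < n \<Longrightarrow> path_ratio \<alpha> i < 1"
    and "i < j" "j \<le> n"
  shows "path_ratio \<alpha> i < path_ratio \<alpha> j"
  using assms(3,4)
proof (induction j)
  case (Suc j)
  have *: "path_ratio \<alpha> j < path_ratio \<alpha> (Suc j)"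
    using lt Suc.prems by (intro path_ratio_less_Suc \<alpha>) auto
  show ?case
  proof (cases "i = j")
    case False
    then show ?thesis using * Suc by (auto simp del: path_ratio.simps intro: less_trans)
  qed (use * in simp)
qed simp

text \<open>Here \<open>s i\<close> is the weight at the spine vertex \<open>i\<close> and
  \<open>E i\<close> the part of it that edge \<open>i\<close> takes. The induction starts at the
  free end: what edge \<open>i + 1\<close> leaves of \<open>s (Suc i)\<close> belongs to edge
  \<open>i\<close>, and dividing \<open>E i ^ 2\<close> by this gives the share of edge
  \<open>i\<close> at its near end.\<close>

lemma path_ratio_eigen:
  assumes s: "\<And>i. i \<le> m \<Longrightarrow> s i > 0" and E: "\<And>i. i < m \<Longrightarrow> E i > 0" "E m = 0"
    and prod: "\<And>i. i < m \<Longrightarrow> E i ^ 2 = \<alpha> * s i * s (Suc i)"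
    and sum: "\<And>i. i < m \<Longrightarrow> s (Suc i) = E i + E (Suc i)" and j: "j \<le> m"
  shows "E (m - j) = path_ratio \<alpha> j * s (m - j)" and "j < m \<Longrightarrow> path_ratio \<alpha> j < 1"
proof -
  \<comment> \<open>For \<open>j < m\<close> the vertex \<open>m - j\<close> also lies on the
    preceding edge, which takes a positive share. The induction needs this bound to divide by
    \<open>1 - path_ratio \<alpha> j\<close>.\<close>
  have less1: "path_ratio \<alpha> j < 1"
    if "E (m - j) = path_ratio \<alpha> j * s (m - j)" "j < m" for j
  proof -
    have "m - j = Suc (m - Suc j)" using that by simp
    then have "path_ratio \<alpha> j * s (m - j) < s (m - j)"
      using sum[of "m - Suc j"] E(1)[of "m - Suc j"] that by simp
    then show ?thesis using s[of "m - j"] by simp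
  qed
  show *: "E (m - j) = path_ratio \<alpha> j * s (m - j)" using j
  proof (induction j)
    case 0
    then show ?case using E by simp
  next
    case (Suc j)
    define i where "i = m - Suc j"
    have i: "i < m" "m - j = Suc i" using Suc.prems by (auto simp: i_def)
    have IH: "E (Suc i) = path_ratio \<alpha> j * s (Suc i)" using Suc i by simp
    have lt: "path_ratio \<alpha> j < 1" using less1[of j] Suc by simp
    have "E i = (1 - path_ratio \<alpha> j) * s (Suc i)"
      using sum[OF i(1)] IH by (simp add: algebra_simps)
    moreover have "E i * E i = \<alpha> * s i * s (Suc i)"
      using prod[OF i(1)] by (simp add: power2_eq_square)
    ultimately have "E i * (E i * (1 - path_ratio \<alpha> j)) = E i * (\<alpha> * s i)"
      by (metis (no_types, opaque_lifting) mult.assoc mult.commute)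
    then have "E i * (1 - path_ratio \<alpha> j) = \<alpha> * s i"
      using E(1)[OF i(1)] by simp
    then show ?case using lt unfolding i_def[symmetric] by (simp add: field_simps)
  qed
  show "path_ratio \<alpha> j < 1" if "j < m" using less1 * that .
qed

text \<open>
  A path of length \<open>m\<close> attached at \<open>z\<close> acts on an eigenvector of the rest of the hypergraph
  like a loss of the fraction \<open>path_ratio (1 / \<mu> ^ r) m\<close> of the weight at \<open>z\<close>.
\<close>

lemma attach_path_eigen:
  assumes K: "uniform_hypergraph r K" and r: "r \<ge> 2" and z: "z \<in> verts K" and \<mu>: "\<mu> > 0"
    and pos: "\<And>a. a \<in> verts (attach_path r m z K) \<Longrightarrow> x a > 0"
    and eig: "\<And>a. a \<in> verts (attach_path r m z K) \<Longrightarrow> \<mu> * (1 - d a) * x a ^ r =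
      (\<Sum>f\<in>edges (attach_path r m z K). if a \<in> f then prod x f else 0)"
    and d: "d (Inl z) = 0" "\<And>p. d (Inr p) = 0"
  shows "\<And>a. a \<in> verts K \<Longrightarrow>
      \<mu> * (1 - ((d \<circ> Inl)(z := path_ratio (1 / \<mu> ^ r) m)) a) * x (Inl a) ^ r =
      (\<Sum>f\<in>edges K. if a \<in> f then \<Prod>b\<in>f. x (Inl b) else 0)"
    and "\<And>j. j < m \<Longrightarrow> path_ratio (1 / \<mu> ^ r) j < 1"
proof -
  let ?G = "attach_path r m z K"
  \<comment> \<open>The value 0 from index \<open>m\<close> on stands for the missing edge beyond
    the free end, so that \<open>sum\<close> also covers the last vertex.\<close>
  define E where "E = (\<lambda>i. if i < m then prod x (glue z ` path_edge r i) else 0)"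
  define s where "s = (\<lambda>i. \<mu> * x (glue z (Spine i)) ^ r)"
  note finE = uniform_finite_edges[OF K]
  have V: "Inl z \<in> verts ?G" "\<And>i. i < m \<Longrightarrow> Inr (Spine (Suc i)) \<in> verts ?G"
    "\<And>i j. i < m \<Longrightarrow> j < r - 2 \<Longrightarrow> Inr (Extra i j) \<in> verts ?G"
    "\<And>a. a \<in> verts K \<Longrightarrow> Inl a \<in> verts ?G"
    using z unfolding verts_attach_path[OF z] by auto
  have spine: "glue z (Spine i) \<in> verts ?G" if "i \<le> m" for i
    using V that by (cases i) auto
  have spos: "s i > 0" if "i \<le> m" for i
    using pos[OF spine[OF that]] \<mu> by (simp add: s_def)
  have Epos: "E i > 0" if "i < m" for i
    using that V pos spine[of i] unfolding E_def by (auto simp: prod_glue_path_edge intro!: mult_pos_pos prod_pos)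
  have old: "\<mu> * (1 - d (Inl a)) * x (Inl a) ^ r =
      (\<Sum>f\<in>edges K. if a \<in> f then \<Prod>b\<in>f. x (Inl b) else 0) + (if a = z then E 0 else 0)"
    if "a \<in> verts K" for a
  proof -
    have "(\<Sum>f\<in>edges K. if Inl a \<in> Inl ` f then prod x (Inl ` f) else 0)
        = (\<Sum>f\<in>edges K. if a \<in> f then \<Prod>b\<in>f. x (Inl b) else 0)"
      by (intro sum.cong) (auto simp: prod.reindex)
    moreover have "(\<Sum>i<m. if Inl a \<in> glue z ` path_edge r i then prod x (glue z ` path_edge r i) else 0)
      = (\<Sum>i<m. if i = 0 then if a = z then E 0 else 0 else 0)"
      by (intro sum.cong) (auto simp: E_def)
    then have "(\<Sum>i<m. if Inl a \<in> glue z ` path_edge r i then prod x (glue z ` path_edge r i) else 0)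
      = (if a = z then E 0 else 0)"
      by (simp add: E_def)
    ultimately show ?thesis using eig[OF V(4)[OF that]] by (simp add: sum_edges_attach_path[OF finE])
  qed
  have sum: "s (Suc i) = E i + E (Suc i)" if i: "i < m" for i
  proof -
    have "s (Suc i) = (\<Sum>i'<m. if Inr (Spine (Suc i)) \<in> glue z ` path_edge r i'
        then prod x (glue z ` path_edge r i') else 0)"
      using eig[OF V(2)[OF i]] d by (simp add: s_def sum_edges_attach_path[OF finE] image_iff)
    also have "\<dots> = (\<Sum>i'<m. (if i' = i then E i else 0) + (if i' = Suc i then E (Suc i) else 0))"
      by (intro sum.cong) (auto simp: E_def)
    also have "\<dots> = E i + E (Suc i)" using i by (simp add: sum.distrib E_def)
    finally show ?thesis .
  qed
  have extra: "\<mu> * x (Inr (Extra i j)) ^ r = E i" if i: "i < m" "j < r - 2" for i j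
  proof -
    have "\<mu> * x (Inr (Extra i j)) ^ r = (\<Sum>i'<m. if Inr (Extra i j) \<in> glue z ` path_edge r i'
        then prod x (glue z ` path_edge r i') else 0)"
      using eig[OF V(3)[OF i]] d by (simp add: sum_edges_attach_path[OF finE] image_iff)
    also have "\<dots> = (\<Sum>i'<m. if i' = i then E i else 0)"
      using i by (intro sum.cong) (auto simp: E_def)
    also have "\<dots> = E i" using i by simp
    finally show ?thesis .
  qed
  \<comment> \<open>Multiply the weights of all \<open>r\<close> vertices of the edge. Each of the
    \<open>r - 2\<close> extra vertices lies on this edge only and has weight \<open>E i\<close>;
    cancelling these factors leaves the square.\<close>
  have sq: "E i ^ 2 = 1 / \<mu> ^ r * s i * s (Suc i)" if i: "i < m" for i
  proof -
    have "\<mu> ^ r * E i ^ r = s i * s (Suc i) * (\<Prod>j<r - 2. \<mu> * x (Inr (Extra i j)) ^ r)"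
    proof -
      have "\<mu> ^ r = \<mu> * \<mu> * \<mu> ^ (r - 2)"
        using r by (metis le_add_diff_inverse power2_eq_square power_add)
      then show ?thesis
        using i by (simp add: E_def prod_glue_path_edge s_def prod.distrib power_mult_distrib
            prod_power_distrib)
    qed
    also have "(\<Prod>j<r - 2. \<mu> * x (Inr (Extra i j)) ^ r) = E i ^ (r - 2)"
      using extra[OF i] by simp
    finally have "\<mu> ^ r * E i ^ r = s i * s (Suc i) * E i ^ (r - 2)" .
    moreover have "E i ^ r = E i ^ (r - 2) * E i ^ 2"
      using r by (metis le_add_diff_inverse2 power_add)
    ultimately have "E i ^ (r - 2) * (\<mu> ^ r * E i ^ 2) = E i ^ (r - 2) * (s i * s (Suc i))"
      by (simp only: ac_simps)
    then have "\<mu> ^ r * E i ^ 2 = s i * s (Suc i)" using Epos[OF i] by simp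
    then show ?thesis using \<mu> by (simp add: field_simps)
  qed
  note * = path_ratio_eigen[of m s E "1 / \<mu> ^ r", OF spos Epos _ sq sum]
  have Em: "E m = 0" by (simp add: E_def)
  show "path_ratio (1 / \<mu> ^ r) j < 1" if "j < m" for j
    using *(2)[of j] that Em by simp
  have "E 0 = path_ratio (1 / \<mu> ^ r) m * s 0" using *(1)[of m] Em by simp
  then show "\<mu> * (1 - ((d \<circ> Inl)(z := path_ratio (1 / \<mu> ^ r) m)) a) * x (Inl a) ^ r =
      (\<Sum>f\<in>edges K. if a \<in> f then \<Prod>b\<in>f. x (Inl b) else 0)" if "a \<in> verts K" for a
    using old[OF that] d by (auto simp: s_def algebra_simps)
qed

section \<open>Upper bounds for the form with attached paths\<close>

text \<open>Every path edge gets the weights of the eigenvector computation: \<open>\<mu>\<close>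
  times the path ratio at the near end, \<open>\<mu>\<close> times the complementary fraction at the
  far end, and \<open>\<mu>\<close> elsewhere. Their product is 1 by the recursion. The shares at an
  inner spine vertex add up to 1, so after summation only the share at \<open>z\<close>
  remains.\<close>

lemma sum_path_edges_le:
  assumes r: "r \<ge> 2" and \<mu>: "\<mu> > 0"
    and lt: "\<And>j. j < m \<Longrightarrow> path_ratio (1 / \<mu> ^ r) j < 1"
    and y: "\<And>p. p \<in> verts (hyperpath r m) \<Longrightarrow> y (glue z p) \<ge> 0"
  shows "(\<Sum>i<m. prod y (glue z ` path_edge r i)) \<le> \<mu> / r *
    (path_ratio (1 / \<mu> ^ r) m * y (Inl z) ^ r +
      (\<Sum>i<m. y (Inr (Spine (Suc i))) ^ r + (\<Sum>j<r - 2. y (Inr (Extra i j)) ^ r)))"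
proof -
  define F where "F = path_ratio (1 / \<mu> ^ r)"
  \<comment> \<open>The near-end share of edge \<open>i\<close>. Its far-end share is the spine term
    of \<open>g i\<close> minus \<open>h (Suc i)\<close>, which makes the sum telescope.\<close>
  define h where "h = (\<lambda>i. F (m - i) * y (glue z (Spine i)) ^ r)"
  define g where "g = (\<lambda>i. y (Inr (Spine (Suc i))) ^ r + (\<Sum>j<r - 2. y (Inr (Extra i j)) ^ r))"
  have Fpos: "F j > 0" if "0 < j" "j \<le> m" for j
    unfolding F_def using that \<mu> by (intro path_ratio_pos lt) auto
  have edge: "prod y (glue z ` path_edge r i) \<le> \<mu> / r * (h i - h (Suc i) + g i)"
    if i: "i < m" for i
  proof -
    let ?a = "glue z (Spine i)" and ?b = "Inr (Spine (Suc i)) :: 'a + path_vertex"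
    define c where "c = (\<lambda>q. \<mu> * (if q = ?a then F (m - i)
        else if q = ?b then 1 - F (m - Suc i) else 1))"
    have ab: "?b \<noteq> ?a" "\<And>j. Inr (Extra i j) \<noteq> ?a" "\<And>j. Inr (Extra i j) \<noteq> ?b"
      by (auto simp: glue_def)
    have lt1: "F (m - Suc i) < 1" using lt[of "m - Suc i"] i by (simp add: F_def)
    have "m - i = Suc (m - Suc i)" using i by simp
    then have "F (m - i) = 1 / \<mu> ^ r / (1 - F (m - Suc i))"
      unfolding F_def by (metis path_ratio.simps(2))
    then have FF: "F (m - i) * (1 - F (m - Suc i)) = 1 / \<mu> ^ r" using lt1 by simp
    have "\<mu> * \<mu> * \<mu> ^ (r - 2) = \<mu> ^ r"
      using r by (metis le_add_diff_inverse power2_eq_square power_add)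
    then have "prod c (glue z ` path_edge r i) = \<mu> ^ r * (F (m - i) * (1 - F (m - Suc i)))"
      using ab by (simp add: prod_glue_path_edge c_def)
    then have c1: "prod c (glue z ` path_edge r i) = 1" using FF \<mu> by simp
    have "c q > 0" for q using \<mu> lt1 Fpos[of "m - i"] i by (auto simp: c_def)
    moreover have "card (glue z ` path_edge r i) = r"
      using card_path_edge[OF r] card_image inj_glue inj_on_subset by (metis subset_UNIV)
    moreover have "path_edge r i \<subseteq> verts (hyperpath r m)"
      using i by (auto simp: path_edge_def hyperpath_def)
    then have "y q \<ge> 0" if "q \<in> glue z ` path_edge r i" for q using that y by auto
    ultimately have "prod y (glue z ` path_edge r i) \<le>
        (\<Sum>q\<in>glue z ` path_edge r i. c q * y q ^ r) / r"
      using r c1 by (intro prod_le_weighted_power_sum) auto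
    also have "(\<Sum>q\<in>glue z ` path_edge r i. c q * y q ^ r) = \<mu> * (h i - h (Suc i) + g i)"
      using ab by (simp add: sum_glue_path_edge c_def h_def g_def algebra_simps sum_distrib_left)
    finally show ?thesis by simp
  qed
  have "(\<Sum>i<m. prod y (glue z ` path_edge r i)) \<le> (\<Sum>i<m. \<mu> / r * (h i - h (Suc i) + g i))"
    by (intro sum_mono edge) auto
  also have "\<dots> = \<mu> / r * ((\<Sum>i<m. h i - h (Suc i)) + (\<Sum>i<m. g i))"
    by (simp only: sum_distrib_left[symmetric] sum.distrib)
  also have "(\<Sum>i<m. h i - h (Suc i)) = h 0 - h m" by (rule sum_lessThan_telescope')
  also have "h m = 0" by (simp add: h_def F_def)
  finally show ?thesis by (simp add: h_def F_def g_def)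
qed

text \<open>The fraction that the hypothesis on \<open>K\<close> withholds at \<open>z\<close> is
  exactly what the path consumes there. The function \<open>d\<close> keeps the fractions reserved
  for paths still to be attached at other vertices.\<close>

lemma attach_path_sum_edges_less:
  assumes K: "uniform_hypergraph r K" and r: "r \<ge> 2" and z: "z \<in> verts K" and \<mu>: "\<mu> > 0"
    and lt: "\<And>j. j < m \<Longrightarrow> path_ratio (1 / \<mu> ^ r) j < 1"
    and y: "\<And>a. a \<in> verts (attach_path r m z K) \<Longrightarrow> y a \<ge> 0"
    and d: "d (Inl z) = 0" "\<And>p. d (Inr p) = 0"
    and less: "(\<Sum>f\<in>edges K. \<Prod>b\<in>f. y (Inl b)) < \<mu> / r *
      (\<Sum>a\<in>verts K. (1 - ((d \<circ> Inl)(z := path_ratio (1 / \<mu> ^ r) m)) a) * y (Inl a) ^ r)"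
  shows "(\<Sum>f\<in>edges (attach_path r m z K). prod y f) <
    \<mu> / r * (\<Sum>a\<in>verts (attach_path r m z K). (1 - d a) * y a ^ r)"
proof -
  let ?F = "path_ratio (1 / \<mu> ^ r) m"
  have fin: "finite (verts K)" using K by (simp add: uniform_hypergraph_def)
  have "(1 - ((d \<circ> Inl)(z := ?F)) a) * y (Inl a) ^ r =
      (1 - d (Inl a)) * y (Inl a) ^ r - (if a = z then ?F * y (Inl z) ^ r else 0)" for a
    using d by (simp add: algebra_simps)
  then have K_sum: "(\<Sum>a\<in>verts K. (1 - ((d \<circ> Inl)(z := ?F)) a) * y (Inl a) ^ r) =
      (\<Sum>a\<in>verts K. (1 - d (Inl a)) * y (Inl a) ^ r) - ?F * y (Inl z) ^ r"
    using fin z by (simp add: sum_subtractf)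
  have "y (glue z p) \<ge> 0" if "p \<in> verts (hyperpath r m)" for p
    using that by (intro y) (simp add: attach_path_def)
  note path = sum_path_edges_le[OF r \<mu> lt, where y = y and z = z, OF _ this]
  have "(\<Sum>f\<in>edges (attach_path r m z K). prod y f) =
      (\<Sum>f\<in>edges K. \<Prod>b\<in>f. y (Inl b)) + (\<Sum>i<m. prod y (glue z ` path_edge r i))"
    by (simp add: sum_edges_attach_path[OF uniform_finite_edges[OF K]] prod.reindex)
  also have "\<dots> < \<mu> / r * ((\<Sum>a\<in>verts K. (1 - d (Inl a)) * y (Inl a) ^ r) - ?F * y (Inl z) ^ r) +
      \<mu> / r * (?F * y (Inl z) ^ r +
      (\<Sum>i<m. y (Inr (Spine (Suc i))) ^ r + (\<Sum>j<r - 2. y (Inr (Extra i j)) ^ r)))"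
    using less path unfolding K_sum by (rule add_less_le_mono)
  also have "\<dots> = \<mu> / r * (\<Sum>a\<in>verts (attach_path r m z K). (1 - d a) * y a ^ r)"
    unfolding sum_verts_attach_path[OF fin z] using d by (simp add: algebra_simps)
  finally show ?thesis .
qed

subsection \<open>Moving an edge between the tails\<close>

lemma prod_two_special:
  assumes "finite e" "u \<in> e" "v \<in> e" "u \<noteq> v" "\<And>a. a \<in> e \<Longrightarrow> a \<noteq> u \<Longrightarrow> a \<noteq> v \<Longrightarrow> c a = 1"
  shows "prod c e = c u * c v"
proof -
  have "prod c e = prod c {u, v}"
    using assms by (intro prod.mono_neutral_right) auto
  then show ?thesis using assms by simp
qed

text \<open>The situation on \<open>H\<close> alone after both tails have been eliminated: they
  survive only as the fractions \<open>F l\<close> at \<open>u\<close> and \<open>F k\<close> at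
  \<open>v\<close> that are missing in \<open>eig\<close>.\<close>

locale eigenvector_with_tails =
  fixes r k l :: nat and H :: "'a hypergraph" and e :: "'a set" and u v w :: 'a
    and \<mu> :: real and x :: "'a \<Rightarrow> real" and F :: "nat \<Rightarrow> real"
  defines "F \<equiv> path_ratio (1 / \<mu> ^ r)"
  assumes r: "r > 0" and H: "uniform_hypergraph r H" and e: "e \<in> edges H"
    and ue: "u \<in> e" and ve: "v \<in> e" and uv: "u \<noteq> v"
    and u1: "vertex_degree H u = 1" and v1: "vertex_degree H v = 1"
    and we: "w \<in> e" and w1: "vertex_degree H w \<noteq> 1"
    and kl: "k \<le> l" and k1: "k \<ge> 1"
    and \<mu>: "\<mu> > 0" and F_lt: "\<And>j. j < l \<Longrightarrow> F j < 1"
    and x: "\<And>a. a \<in> verts H \<Longrightarrow> x a > 0"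
    and eig: "\<And>a. a \<in> verts H \<Longrightarrow> \<mu> * (1 - ((\<lambda>_. 0)(u := F l, v := F k)) a) * x a ^ r =
      (\<Sum>f\<in>edges H. if a \<in> f then prod x f else 0)"
begin

definition d where "d = (\<lambda>_. 0)(u := F l, v := F k)"

lemma d_simps: "d u = F l" "d v = F k" "a \<noteq> u \<Longrightarrow> a \<noteq> v \<Longrightarrow> d a = 0"
  using uv by (simp_all add: d_def)

lemmas eig_d = eig[folded d_def]

lemma in_verts: "f \<in> edges H \<Longrightarrow> a \<in> f \<Longrightarrow> a \<in> verts H"
  using H by (auto simp: uniform_hypergraph_def)

lemma prod_x_pos: "f \<in> edges H \<Longrightarrow> prod x f > 0"
  using x in_verts by (intro prod_pos) blast

lemma only_edge:
  assumes "vertex_degree H a = 1" "a \<in> e" "f \<in> edges H"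
  shows "a \<in> f \<longleftrightarrow> f = e"
proof -
  obtain g where g: "{f \<in> edges H. a \<in> f} = {g}"
    using assms(1) by (auto simp: vertex_degree_def card_1_singleton_iff)
  have "e \<in> {g}" "f \<in> {g} \<longleftrightarrow> a \<in> f"
    unfolding g[symmetric] using assms(2,3) e by simp_all
  then show ?thesis by simp
qed

lemma eig_end:
  assumes "vertex_degree H a = 1" "a \<in> e"
  shows "\<mu> * (1 - d a) * x a ^ r = prod x e"
proof -
  have "(\<Sum>f\<in>edges H. if a \<in> f then prod x f else 0) = (\<Sum>f\<in>edges H. if f = e then prod x e else 0)"
    using only_edge[OF assms] by (intro sum.cong) auto
  also have "\<dots> = prod x e" using e uniform_finite_edges[OF H] by simp
  finally show ?thesis using eig_d[OF in_verts[OF e assms(2)]] by simp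
qed

text \<open>At \<open>u\<close> and \<open>v\<close> the remaining fraction of a positive weight is
  the positive product over \<open>e\<close>. For \<open>u\<close> this gives
  \<open>F l < 1\<close>, one index beyond \<open>F_lt\<close>.\<close>

lemma d_less_1: "d a < 1"
proof -
  have "1 - d b > 0" if b: "b = u \<or> b = v" for b
  proof -
    have "b \<in> e" "vertex_degree H b = 1" using b ue ve u1 v1 by auto
    then have "(1 - d b) * (\<mu> * x b ^ r) > 0" "\<mu> * x b ^ r > 0"
      using eig_end[of b] prod_x_pos[OF e] \<mu> x in_verts[OF e]
      by (simp_all add: ac_simps del: fun_upd_apply)
    then show ?thesis by (rule zero_less_mult_pos2)
  qed
  then have "d a < 1" if "a = u \<or> a = v" using that by (simp del: fun_upd_apply)
  then show ?thesis by (cases "a = u \<or> a = v") (simp_all add: d_simps)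
qed

lemma F_l_less_1: "F l < 1"
  using d_less_1[of u] by (simp add: d_simps)

lemma F_mono:
  assumes "i < j" "j \<le> Suc l"
  shows "F i < F j"
proof -
  have "F i < 1" if "i < Suc l" for i
    using that F_lt[of i] F_l_less_1 by (cases "i = l") auto
  then show ?thesis
    using path_ratio_strict_mono[of "1 / \<mu> ^ r" "Suc l" i j, folded F_def] \<mu> assms by simp
qed

lemma x_v_le_x_u: "x v \<le> x u"
proof -
  have pos: "x u > 0" "x v > 0" using x in_verts[OF e] ue ve by auto
  have "\<mu> * (1 - F l) * x u ^ r = \<mu> * (1 - F k) * x v ^ r"
    using eig_end[OF u1 ue] eig_end[OF v1 ve] by (simp add: d_simps)
  then have "(1 - F l) * x u ^ r = (1 - F k) * x v ^ r" using \<mu> by simp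
  moreover have "F k \<le> F l" using F_mono[of k l] kl by (cases "k = l") auto
  then have "(1 - F k) * x v ^ r \<ge> (1 - F l) * x v ^ r"
    using pos by (intro mult_right_mono) auto
  ultimately have "(1 - F l) * x v ^ r \<le> (1 - F l) * x u ^ r" by simp
  then have "x v ^ r \<le> x u ^ r" using F_l_less_1 by simp
  then show ?thesis using pos r by simp
qed

text \<open>
  The second edge at \<open>w\<close> is what makes this strict: it takes away a part of the weight at
  \<open>w\<close> from \<open>e\<close>.
\<close>

lemma product_bound: "1 / \<mu> ^ r < (1 - F l) * (1 - F k)"
proof -
  have fe: "finite e" by (rule uniform_finite_edge[OF H e])
  have card: "card e = r" using H e by (auto simp: uniform_hypergraph_def)
  note finE = uniform_finite_edges[OF H]
  have le: "prod x e \<le> \<mu> * (1 - d a) * x a ^ r" if a: "a \<in> e" for a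
  proof -
    have "(if a \<in> e then prod x e else 0) \<le> (\<Sum>f\<in>edges H. if a \<in> f then prod x f else 0)"
      using finE e prod_x_pos by (intro member_le_sum) (auto simp: less_imp_le)
    then show ?thesis using a eig_d[OF in_verts[OF e a]] by simp
  qed
  have "\<exists>g\<in>edges H. w \<in> g \<and> g \<noteq> e"
  proof (rule ccontr)
    assume "\<not> ?thesis"
    then have "{f \<in> edges H. w \<in> f} = {e}" using e we by blast
    then show False using w1 by (simp add: vertex_degree_def)
  qed
  then obtain g where g: "g \<in> edges H" "w \<in> g" "g \<noteq> e" by blast
  have "prod x e + prod x g = (\<Sum>f\<in>{e, g}. if w \<in> f then prod x f else 0)"
    using g we by simp
  also have "\<dots> \<le> (\<Sum>f\<in>edges H. if w \<in> f then prod x f else 0)"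
    using finE e g prod_x_pos by (intro sum_mono2) (auto simp: less_imp_le)
  also have "\<dots> = \<mu> * (1 - d w) * x w ^ r" using eig_d[OF in_verts[OF e we]] by simp
  finally have less: "prod x e < \<mu> * (1 - d w) * x w ^ r"
    using prod_x_pos[OF g(1)] by linarith
  \<comment> \<open>Multiplying over all \<open>r\<close> vertices of \<open>e\<close> turns both
    sides into multiples of \<open>prod x e ^ r\<close>, which then cancels.\<close>
  have "(\<Prod>a\<in>e. prod x e) < (\<Prod>a\<in>e. \<mu> * (1 - d a) * x a ^ r)"
  proof (rule prod_mono_strict)
    show "w \<in> e" "prod x e < \<mu> * (1 - d w) * x w ^ r" "finite e" by (fact we less fe)+
    show "0 \<le> prod x e \<and> prod x e \<le> \<mu> * (1 - d a) * x a ^ r"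
      and "0 < \<mu> * (1 - d a) * x a ^ r" if "a \<in> e" for a
      using le[OF that] prod_x_pos[OF e] by linarith+
  qed
  also have "\<dots> = \<mu> ^ r * (\<Prod>a\<in>e. 1 - d a) * prod x e ^ r"
    by (simp add: prod.distrib prod_power_distrib card del: fun_upd_apply)
  also have "(\<Prod>a\<in>e. 1 - d a) = (1 - F l) * (1 - F k)"
    using prod_two_special[OF fe ue ve uv, of "\<lambda>a. 1 - d a"] by (simp add: d_simps)
  finally have "prod x e ^ r * 1 < prod x e ^ r * (\<mu> ^ r * ((1 - F l) * (1 - F k)))"
    using card by (simp add: mult.commute)
  then have "1 < \<mu> ^ r * ((1 - F l) * (1 - F k))"
    using prod_x_pos[OF e] by (simp del: mult_1_right)
  then show ?thesis using \<mu> by (simp add: field_simps)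
qed

text \<open>By the recursion this is \<open>product_bound\<close> divided by \<open>1 - F l\<close>.
  It also keeps the ratio of the lengthened tail below 1, since \<open>F k\<close> is
  positive.\<close>

lemma F_sum: "F k + F (Suc l) < 1"
proof -
  have "F (Suc l) = 1 / \<mu> ^ r / (1 - F l)" by (simp add: F_def)
  also have "\<dots> < 1 - F k"
    using product_bound F_l_less_1 by (subst pos_divide_less_eq) (auto simp: mult.commute)
  finally show ?thesis by simp
qed

lemma F_0: "F 0 = 0"
  by (simp add: F_def)

lemma F_pos: "0 < j \<Longrightarrow> j \<le> Suc l \<Longrightarrow> F j > 0"
  using F_mono[of 0 j] by (simp add: F_0)

text \<open>
  With \<open>F j * (1 - F (j - 1)) = 1 / \<mu> ^ r\<close> the inequality becomes
  \<open>F k * (1 - F k) < F (l + 1) * (1 - F (l + 1))\<close>.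
\<close>

lemma product_increases: "(1 - F l) * (1 - F k) < (1 - F (Suc l)) * (1 - F (k - 1))"
proof -
  define p where "p = F k"
  define q where "q = F (Suc l)"
  have F_less: "F (k - 1) < 1" using F_lt kl k1 by auto
  have pq: "0 < p" "p < q" "p + q < 1"
    using F_pos[of k] F_mono[of k "Suc l"] F_sum k1 kl by (simp_all add: p_def q_def)
  have rec: "F (Suc j) * (1 - F j) = 1 / \<mu> ^ r" if "F j < 1" for j
    using that by (simp add: F_def)
  have P: "p * (1 - F (k - 1)) = 1 / \<mu> ^ r" using rec[of "k - 1"] F_less k1 by (simp add: p_def)
  have Q: "q * (1 - F l) = 1 / \<mu> ^ r" using rec[of l] F_l_less_1 by (simp add: q_def)
  \<comment> \<open>This product is the difference of \<open>q * (1 - q)\<close> and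
    \<open>p * (1 - p)\<close>.\<close>
  have "0 < (q - p) * (1 - p - q)" using pq by simp
  then have "p * (1 - p) < q * (1 - q)" by (simp add: algebra_simps)
  then have "p * (1 - p) * (1 / \<mu> ^ r) < q * (1 - q) * (1 / \<mu> ^ r)"
    using \<mu> by (intro mult_strict_right_mono) auto
  \<comment> \<open>Expressing \<open>1 / \<mu> ^ r\<close> by \<open>Q\<close> here and by
    \<open>P\<close> below produces the common factor \<open>p * q\<close>.\<close>
  moreover have "p * (1 - p) * (1 / \<mu> ^ r) = p * q * ((1 - F l) * (1 - p))"
    unfolding Q[symmetric] by simp
  moreover have "q * (1 - q) * (1 / \<mu> ^ r) = p * q * ((1 - q) * (1 - F (k - 1)))"
    unfolding P[symmetric] by simp
  ultimately have "p * q * ((1 - F l) * (1 - p)) < p * q * ((1 - q) * (1 - F (k - 1)))"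
    by simp
  then have "(1 - F l) * (1 - p) < (1 - q) * (1 - F (k - 1))"
    using pq by (simp add: mult_less_cancel_left)
  then show ?thesis by (simp add: p_def q_def)
qed

text \<open>Write \<open>y\<close> as \<open>x\<close> times \<open>z\<close> and apply the weighted
  mean inequality to \<open>z\<close> on every edge, with the ratio \<open>c\<close> of new to old
  fractions as weights. Since \<open>u\<close> and \<open>v\<close> lie on \<open>e\<close> only,
  these weights have product 1 on all other edges, and on \<open>e\<close> the product exceeds 1 by
  \<open>product_increases\<close>.\<close>

lemma sum_edges_less:
  assumes y: "\<And>a. a \<in> verts H \<Longrightarrow> y a > 0"
  shows "(\<Sum>f\<in>edges H. prod y f) < \<mu> / r *
    (\<Sum>a\<in>verts H. (1 - ((\<lambda>_. 0)(u := F (Suc l), v := F (k - 1))) a) * y a ^ r)"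
proof -
  let ?d' = "(\<lambda>_. 0)(u := F (Suc l), v := F (k - 1))"
  define c where "c = (\<lambda>a. (1 - ?d' a) / (1 - d a))"
  define z where "z = (\<lambda>a. y a / x a)"
  have fe: "finite e" by (rule uniform_finite_edge[OF H e])
  have fin: "finite (verts H)" and sub: "\<And>f. f \<in> edges H \<Longrightarrow> f \<subseteq> verts H \<and> card f = r"
    using H by (auto simp: uniform_hypergraph_def)
  have "F (Suc l) < 1" using F_sum F_pos[of k] kl k1 by simp
  moreover have "F (k - 1) < 1" using F_lt kl k1 by auto
  ultimately have "?d' a < 1" for a by simp
  then have c0: "c a > 0" for a using d_less_1[of a] by (simp add: c_def del: fun_upd_apply)
  have z0: "z a > 0" if "a \<in> verts H" for a using x y that by (simp add: z_def)
  have ce: "prod c e > 1"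
  proof -
    have "prod c e = c u * c v"
      by (rule prod_two_special[OF fe ue ve uv]) (simp add: c_def d_simps)
    also have "\<dots> = (1 - F (Suc l)) * (1 - F (k - 1)) / ((1 - F l) * (1 - F k))"
      using uv by (simp add: c_def d_simps)
    also have "\<dots> > 1"
      using product_increases d_less_1[of u] d_less_1[of v] by (simp add: d_simps)
    finally show ?thesis .
  qed
  have cf: "prod c f = 1" if "f \<in> edges H" "f \<noteq> e" for f
    using that only_edge[OF u1 ue that(1)] only_edge[OF v1 ve that(1)]
    by (intro prod.neutral) (auto simp: c_def d_simps)
  have yf: "prod y f = prod x f * prod z f" if "f \<in> edges H" for f
    unfolding prod.distrib[symmetric] using that in_verts x
    by (intro prod.cong) (force simp: z_def)+
  have le: "prod y f \<le> prod x f * ((\<Sum>a\<in>f. c a * z a ^ r) / r)" if f: "f \<in> edges H" for f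
  proof -
    have "prod c f \<ge> 1" using ce cf[OF f] by (cases "f = e") auto
    then show ?thesis
      unfolding yf[OF f] using prod_x_pos[OF f] sub[OF f] r c0 z0 in_verts[OF f]
      by (intro mult_left_mono prod_le_weighted_power_sum(1)) (auto simp: less_imp_le)
  qed
  have less: "prod y e < prod x e * ((\<Sum>a\<in>e. c a * z a ^ r) / r)"
    unfolding yf[OF e] using prod_x_pos[OF e] sub[OF e] r c0 z0 in_verts[OF e] ce
    by (intro mult_strict_left_mono prod_le_weighted_power_sum(2)) (auto simp: less_imp_le)
  have "(\<Sum>f\<in>edges H. prod y f) < (\<Sum>f\<in>edges H. prod x f * ((\<Sum>a\<in>f. c a * z a ^ r) / r))"
    using uniform_finite_edges[OF H] e le less by (intro sum_strict_mono_ex1) auto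
  also have "\<dots> = (\<Sum>f\<in>edges H. \<Sum>a\<in>verts H. (if a \<in> f then prod x f else 0) * (c a * z a ^ r)) / r"
  proof -
    have "prod x f * (\<Sum>a\<in>f. c a * z a ^ r) =
        (\<Sum>a\<in>verts H. (if a \<in> f then prod x f else 0) * (c a * z a ^ r))"
      if f: "f \<in> edges H" for f
    proof -
      have "prod x f * (\<Sum>a\<in>f. c a * z a ^ r) =
          (\<Sum>a\<in>f. (if a \<in> f then prod x f else 0) * (c a * z a ^ r))"
        by (simp add: sum_distrib_left)
      also have "\<dots> = (\<Sum>a\<in>verts H. (if a \<in> f then prod x f else 0) * (c a * z a ^ r))"
        using sub[OF f] fin by (intro sum.mono_neutral_left) auto
      finally show ?thesis .
    qed
    then show ?thesis by (subst sum_divide_distrib) (intro sum.cong, auto)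
  qed
  \<comment> \<open>Exchanging the sums collects at each vertex the products over its edges, which
    \<open>eig_d\<close> evaluates.\<close>
  also have "(\<Sum>f\<in>edges H. \<Sum>a\<in>verts H. (if a \<in> f then prod x f else 0) * (c a * z a ^ r)) =
      (\<Sum>a\<in>verts H. \<mu> * (1 - d a) * x a ^ r * (c a * z a ^ r))"
    by (subst sum.swap) (simp add: eig_d sum_distrib_right del: fun_upd_apply)
  also have "\<dots> = (\<Sum>a\<in>verts H. \<mu> * ((1 - ?d' a) * y a ^ r))"
  proof (intro sum.cong refl)
    fix a assume "a \<in> verts H"
    then have "x a ^ r * z a ^ r = y a ^ r"
      using x by (force simp: z_def simp flip: power_mult_distrib)
    moreover have "(1 - d a) * c a = 1 - ?d' a"
      using d_less_1[of a] by (simp add: c_def del: fun_upd_apply)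
    moreover have "\<mu> * (1 - d a) * x a ^ r * (c a * z a ^ r) =
        \<mu> * (((1 - d a) * c a) * (x a ^ r * z a ^ r))"
      by (simp only: ac_simps)
    ultimately show "\<mu> * (1 - d a) * x a ^ r * (c a * z a ^ r) = \<mu> * ((1 - ?d' a) * y a ^ r)"
      by simp
  qed
  finally show ?thesis by (simp flip: sum_distrib_left del: fun_upd_apply)
qed

end

section \<open>Removing and reattaching the two paths\<close>

lemma uniform_two_paths:
  assumes "uniform_hypergraph r H" "r \<ge> 2" "u \<in> verts H" "v \<in> verts H"
  shows "uniform_hypergraph r (two_paths r H v u k l)"
  unfolding two_paths_def using assms
  by (intro uniform_attach_path) (auto simp: attach_path_def)

lemma connected_two_paths:
  assumes "connected_hypergraph H" "u \<in> verts H" "v \<in> verts H"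
  shows "connected_hypergraph (two_paths r H v u k l)"
  unfolding two_paths_def using assms
  by (intro connected_attach_path) (auto simp: attach_path_def)

text \<open>The paths are removed from the outside in: first the one at \<open>u\<close>, with no
  loss elsewhere, then the one at \<open>v\<close>, while the loss \<open>F l\<close> at
  \<open>u\<close> is carried along in \<open>?d\<close>.\<close>

lemma two_paths_eigenvector:
  fixes H :: "'a hypergraph" and r k l :: nat and e :: "'a set" and u v w :: 'a
  assumes "r \<ge> 3"
    and H: "uniform_hypergraph r H" and con: "connected_hypergraph H"
    and e: "e \<in> edges H"
    and "u \<in> e" and "v \<in> e" and "u \<noteq> v" and "vertex_degree H u = 1" and "vertex_degree H v = 1"
    and "w \<in> e" and "vertex_degree H w \<noteq> 1"
    and "l \<ge> k" and "k \<ge> 1"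
    and x: "perron_frobenius_vector r (two_paths r H v u k l) x"
  shows "eigenvector_with_tails r k l H e u v w
    (spectral_radius r (two_paths r H v u k l) / fact (r - 1)) (\<lambda>a. x (Inl (Inl a)))"
proof -
  let ?K = "attach_path r k v H" and ?G = "two_paths r H v u k l"
  define \<mu> where "\<mu> = spectral_radius r ?G / fact (r - 1)"
  have uV: "u \<in> verts H" and vV: "v \<in> verts H"
    using H e \<open>u \<in> e\<close> \<open>v \<in> e\<close> by (auto simp: uniform_hypergraph_def)
  have r2: "r \<ge> 2" "r > 0" using \<open>r \<ge> 3\<close> by auto
  note G = uniform_two_paths[OF H r2(1) uV vV, of k l] connected_two_paths[OF con uV vV, of r k l]
  have K: "uniform_hypergraph r ?K" using uniform_attach_path[OF H r2(1) vV] .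
  have uK: "Inl u \<in> verts ?K" and VK: "\<And>a. a \<in> verts H \<Longrightarrow> Inl a \<in> verts ?K"
    and VG: "\<And>a. a \<in> verts ?K \<Longrightarrow> Inl a \<in> verts ?G"
    using uV by (auto simp: attach_path_def two_paths_def)
  have pos: "\<And>a. a \<in> verts ?G \<Longrightarrow> x a > 0"
    using perron_frobenius_vector_pos[OF G r2(2) x] .
  have eig: "\<And>a. a \<in> verts ?G \<Longrightarrow> \<mu> * x a ^ r = (\<Sum>f\<in>edges ?G. if a \<in> f then prod x f else 0)"
    unfolding \<mu>_def using perron_frobenius_vector_eigen[OF G r2(2) x] .
  have \<mu>0: "\<mu> > 0"
  proof -
    have "Inl ` Inl ` e \<in> edges ?G" using e by (auto simp: two_paths_def edges_attach_path)
    moreover have "prod x f > 0" if "f \<in> edges ?G" for f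
      using that G(1) pos by (intro prod_pos) (auto simp: uniform_hypergraph_def)
    ultimately have "(\<Sum>f\<in>edges ?G. prod x f) > 0"
      using uniform_finite_edges[OF G(1)] by (intro sum_pos) auto
    moreover have "spectral_radius r ?G = fact r * (\<Sum>f\<in>edges ?G. prod x f)"
      using x by (simp add: perron_frobenius_vector_def edge_form_def)
    ultimately show ?thesis by (simp add: \<mu>_def)
  qed
  let ?F = "path_ratio (1 / \<mu> ^ r)"
  let ?d = "(\<lambda>_. 0)(Inl u := ?F l) :: 'a + path_vertex \<Rightarrow> real"
  note outer = attach_path_eigen[OF K r2(1) uK \<mu>0, of l x "\<lambda>_. 0", folded two_paths_def, OF pos]
  have eigK: "\<mu> * (1 - ?d a) * x (Inl a) ^ r =
      (\<Sum>f\<in>edges ?K. if a \<in> f then \<Prod>b\<in>f. x (Inl b) else 0)" if "a \<in> verts ?K" for a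
    using outer(1)[of a] eig that by (simp add: comp_def del: fun_upd_apply)
  note inner = attach_path_eigen[OF H r2(1) vV \<mu>0, of k "\<lambda>a. x (Inl a)" ?d, OF pos[OF VG] eigK]
  have d: "(?d \<circ> Inl)(v := ?F k) = (\<lambda>_. 0)(u := ?F l, v := ?F k)"
    by (auto simp: fun_eq_iff)
  show ?thesis
    unfolding \<mu>_def[symmetric]
  \<comment> \<open>Goals 14, 15 and 16 are \<open>F_lt\<close>, \<open>x\<close> and
    \<open>eig\<close> of the locale.\<close>
  proof (unfold_locales, goal_cases)
    case (14 j)
    then show ?case using outer(2)[of j] eig by simp
  next
    case (15 a)
    then show ?case using pos VK VG by blast
  next
    case (16 a)
    then show ?case
      unfolding d[symmetric] using \<open>u \<noteq> v\<close> by (intro inner(1)) simp_all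
  qed (use assms \<mu>0 in auto)
qed

theorem theorem3p3:
  fixes H :: "'a hypergraph" and r k l :: nat and e :: "'a set" and u v w :: 'a
  assumes "r \<ge> 3"
    and "uniform_hypergraph r H" and "connected_hypergraph H"
    and "e \<in> edges H"
    and "u \<in> e" and "v \<in> e" and "u \<noteq> v" and "vertex_degree H u = 1" and "vertex_degree H v = 1"
    and "w \<in> e" and "vertex_degree H w \<noteq> 1"
    and "l \<ge> k" and "k \<ge> 1"
  shows "(\<forall>x. perron_frobenius_vector r (two_paths r H v u k l) x
              \<longrightarrow> x (Inl (Inl u)) \<ge> x (Inl (Inl v)))
       \<and> spectral_radius r (two_paths r H v u k l)
           > spectral_radius r (two_paths r H v u (k - 1) (l + 1))"
proof (intro conjI allI impI)
  note tails = two_paths_eigenvector[OF assms]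
  show "x (Inl (Inl u)) \<ge> x (Inl (Inl v))"
    if "perron_frobenius_vector r (two_paths r H v u k l) x" for x
    using eigenvector_with_tails.x_v_le_x_u[OF tails[OF that]] .
  let ?G = "two_paths r H v u k l" and ?G' = "two_paths r H v u (k - 1) (l + 1)"
  let ?K' = "attach_path r (k - 1) v H"
  define \<mu> where "\<mu> = spectral_radius r ?G / fact (r - 1)"
  have uV: "u \<in> verts H" and vV: "v \<in> verts H"
    using assms by (auto simp: uniform_hypergraph_def)
  have r2: "r \<ge> 2" "r > 0" using \<open>r \<ge> 3\<close> by auto
  have V: "Inl (Inl u) \<in> verts (two_paths r H v u i j)" for i j
    using uV by (auto simp: attach_path_def two_paths_def)
  note uniform = uniform_two_paths[OF assms(2) r2(1) uV vV]
  note connected = connected_two_paths[OF assms(3) uV vV, of r]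
  obtain x where "perron_frobenius_vector r ?G x"
    using perron_frobenius_vector_exists[OF uniform _ r2(2)] V by (metis empty_iff)
  then interpret eigenvector_with_tails r k l H e u v w \<mu> "\<lambda>a. x (Inl (Inl a))" "path_ratio (1 / \<mu> ^ r)"
    unfolding \<mu>_def by (rule tails) simp
  obtain y where y: "perron_frobenius_vector r ?G' y"
    using perron_frobenius_vector_exists[OF uniform _ r2(2)] V by (metis empty_iff)
  have pos: "\<And>a. a \<in> verts ?G' \<Longrightarrow> y a > 0"
    using perron_frobenius_vector_pos[OF uniform connected r2(2) y] .
  have uK: "Inl u \<in> verts ?K'" and VK: "\<And>a. a \<in> verts H \<Longrightarrow> Inl a \<in> verts ?K'"
    and VG: "\<And>a. a \<in> verts ?K' \<Longrightarrow> Inl a \<in> verts ?G'"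
    using uV by (auto simp: attach_path_def two_paths_def)
  \<comment> \<open>The tail at \<open>u\<close> now has \<open>l + 1\<close> edges, so the bound is
    also needed at index \<open>l\<close>.\<close>
  have lt: "path_ratio (1 / \<mu> ^ r) j < 1" if "j < l + 1" for j
    using that F_lt F_l_less_1 by (auto simp: less_Suc_eq)
  let ?d = "(\<lambda>_. 0)(Inl u := path_ratio (1 / \<mu> ^ r) (l + 1))"
  have d: "(?d \<circ> Inl)(v := path_ratio (1 / \<mu> ^ r) (k - 1)) =
      (\<lambda>_. 0)(u := path_ratio (1 / \<mu> ^ r) (Suc l), v := path_ratio (1 / \<mu> ^ r) (k - 1))"
    by (auto simp: fun_eq_iff)
  \<comment> \<open>The strict bound on \<open>H\<close> for the vector \<open>y\<close> of the
    changed hypergraph is lifted through the path at \<open>v\<close>, then through the path at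
    \<open>u\<close>, in the order of attachment.\<close>
  have "(\<Sum>f\<in>edges ?K'. \<Prod>b\<in>f. y (Inl b)) <
      \<mu> / r * (\<Sum>a\<in>verts ?K'. (1 - ?d a) * y (Inl a) ^ r)"
  proof (rule attach_path_sum_edges_less[OF H r2(1) vV \<mu>])
    show "(\<Sum>f\<in>edges H. \<Prod>b\<in>f. y (Inl (Inl b))) < \<mu> / r *
        (\<Sum>a\<in>verts H. (1 - ((?d \<circ> Inl)(v := path_ratio (1 / \<mu> ^ r) (k - 1))) a) * y (Inl (Inl a)) ^ r)"
      unfolding d using pos VK VG by (intro sum_edges_less) auto
  qed (use lt pos VG uv kl in \<open>auto simp: less_imp_le\<close>)
  \<comment> \<open>No path remains to be attached, so the reserved fraction is 0 everywhere;
    \<open>1 - 0\<close> matches the form of \<open>1 - d a\<close>.\<close>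
  then have "(\<Sum>f\<in>edges ?G'. prod y f) < \<mu> / r * (\<Sum>a\<in>verts ?G'. (1 - 0) * y a ^ r)"
    unfolding two_paths_def
    by (intro attach_path_sum_edges_less[OF uniform_attach_path[OF H r2(1) vV] r2(1) uK \<mu>])
      (use lt pos in \<open>auto simp: less_imp_le two_paths_def comp_def simp del: path_ratio.simps fun_upd_apply\<close>)
  also have "\<dots> = \<mu> / r" using y by (simp add: perron_frobenius_vector_def)
  finally have "fact r * (\<Sum>f\<in>edges ?G'. prod y f) < fact r * (\<mu> / r)"
    by (intro mult_strict_left_mono) auto
  also have "\<dots> = spectral_radius r ?G"
    using r2 by (simp add: \<mu>_def fact_reduce[of r])
  finally show "spectral_radius r ?G' < spectral_radius r ?G"
    using y by (simp add: perron_frobenius_vector_def edge_form_def)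
qed

end
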